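(* Let $\mathbf{k}=(k_1,\ldots,k_n)$ be a tuple of positive integers with weight $(a_1,\ldots,a_\ell;t_1,\ldots,t_\ell;a)$, and let $P_{\mathbf{k}}$ be the $\mathbf{k}$-Stirling poset. Then for every positive integer $m$, $B_{\mathbf{k}}(m)=\Omega(P_{\mathbf{k}},m)$ and $b_{\mathbf{k}}(m)=\overline{\Omega}(P_{\mathbf{k}},m)$.
   Context: For a tuple $\mathbf{k}=(k_1,\ldots,k_n)$ of positive integers, $K=k_1+\cdots+k_n$: a Stirling permutation of the multiset $\{1^{k_1},\ldots,n^{k_n}\}$ is a word $\sigma(1)\cdots\sigma(K)$ containing each $i$ exactly $k_i$ times such that $\sigma(i)=\sigma(j)$, $i<s<j$ imply $\sigma(s)\ge\sigma(i)$. An index $i\in\{1,\ldots,K\}$ is a descent if $i<K$ and $\sigma(i)>\sigma(i+1)$, or $i=K$. $A_{\mathbf{k},i}$ is the number of Stirling permutations with exactly $i$ descents, and $B_{\mathbf{k}}(m),b_{\mathbf{k}}(m)$ are defined by $\frac{\sum_{i=1}^{n}A_{\mathbf{k},i}x^i}{(1-x)^{K+1}}=\sum_{m\ge0}B_{\mathbf{k}}(m)x^m$ and $\frac{\sum_{i=K-n+1}^{K}A_{\mathbf{k},K+1-i}x^i}{(1-x)^{K+1}}=\sum_{m\ge0}b_{\mathbf{k}}(m)x^m$. Weight: $\mathbf{k}$ has length $\ell$ and weight $(a_1,\ldots,a_\ell;t_1,\ldots,t_\ell;a)$, with $a_i\ge1$, $t_i\ge2$, $a\ge0$, if $\mathbf{k}=(1^{a_1-1},t_1,1^{a_2-1},t_2,\ldots,1^{a_\ell-1},t_\ell,1^{a})$,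 where $1^r$ denotes $r$ consecutive entries equal to $1$. The $\mathbf{k}$-Stirling poset $P_{\mathbf{k}}$ has $K$ elements: for each $1\le i\le\ell$, elements $u_{i,1},\ldots,u_{i,a_i}$, $c_i$, $d_{i,1},\ldots,d_{i,t_i-2}$, plus $a$ further elements $e_1,\ldots,e_a$. Its order is generated by the relations $u_{i,j}<c_i$ ($1\le j\le a_i$), $c_i<d_{i,1}<\cdots<d_{i,t_i-2}$, and $d_{i,t_i-2}<c_{i+1}$ (or $c_i<c_{i+1}$ if $t_i=2$) for $i<\ell$; the $e_j$ are incomparable with all other elements. For a finite poset $P$, $\Omega(P,m)$ is the number of maps $f:P\to\{1,\ldots,m\}$ with $x<y\Rightarrow f(x)\le f(y)$, and $\overline{\Omega}(P,m)$ the number with $x<y\Rightarrow f(x)<f(y)$. *)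

theory Defs
  imports "HOL-Computational_Algebra.Formal_Power_Series" "HOL-Library.FuncSet"
begin

text \<open>
  The tuple \<open>(k_1, \<dots>, k_n)\<close> is the list \<open>k\<close> with \<open>n = length k\<close> and \<open>K = sum_list k\<close>.
  Lists are 0-based: the entry \<open>k_i\<close> is \<open>k ! (i - 1)\<close>, the letter \<open>\<sigma>(i)\<close> is \<open>\<sigma> ! (i - 1)\<close>.
\<close>

definition stirling_perms :: "nat list \<Rightarrow> nat list set" where
  "stirling_perms k =
     {\<sigma>. length \<sigma> = sum_list k \<and> set \<sigma> \<subseteq> {1..length k} \<and>
         (\<forall>i\<in>{1..length k}. count_list \<sigma> i = k ! (i - 1)) \<and>
         (\<forall>i s j. i < s \<and> s < j \<and> j < length \<sigma> \<and> \<sigma> ! i = \<sigma> ! j \<longrightarrow> \<sigma> ! s \<ge> \<sigma> ! i)}"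

definition descents :: "nat list \<Rightarrow> nat set" where
  "descents \<sigma> =
     {i \<in> {1..length \<sigma>}. (i < length \<sigma> \<and> \<sigma> ! (i - 1) > \<sigma> ! i) \<or> i = length \<sigma>}"

definition A_num :: "nat list \<Rightarrow> nat \<Rightarrow> nat" where
  "A_num k i = card {\<sigma> \<in> stirling_perms k. card (descents \<sigma>) = i}"

definition B_num :: "nat list \<Rightarrow> nat \<Rightarrow> rat" where
  "B_num k m =
     fps_nth ((\<Sum>i = 1..length k. of_nat (A_num k i) * fps_X ^ i)
              / (1 - fps_X) ^ (sum_list k + 1)) m"

definition b_num :: "nat list \<Rightarrow> nat \<Rightarrow> rat" where
  "b_num k m =
     fps_nth ((\<Sum>i = sum_list k - length k + 1..sum_list k.
                 of_nat (A_num k (sum_list k + 1 - i)) * fps_X ^ i)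
              / (1 - fps_X) ^ (sum_list k + 1)) m"

text \<open>
  The length \<open>\<ell>\<close> of the weight is \<open>length ts\<close>; it may be \<open>0\<close>, namely for \<open>k = (1, \<dots>, 1)\<close>.
\<close>

definition has_weight :: "nat list \<Rightarrow> nat list \<Rightarrow> nat list \<Rightarrow> nat \<Rightarrow> bool" where
  "has_weight k as ts a \<longleftrightarrow>
     length as = length ts \<and> (\<forall>x\<in>set as. x \<ge> 1) \<and> (\<forall>t\<in>set ts. t \<ge> 2) \<and>
     k = concat (map2 (\<lambda>x t. replicate (x - 1) 1 @ [t]) as ts) @ replicate a 1"

datatype stirling_elem = U nat nat | C nat | D nat nat | E nat

definition stirling_carrier :: "nat list \<Rightarrow> nat list \<Rightarrow> nat \<Rightarrow> stirling_elem set" where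
  "stirling_carrier as ts a =
     {U i j | i j. 1 \<le> i \<and> i \<le> length ts \<and> 1 \<le> j \<and> j \<le> as ! (i - 1)} \<union>
     {C i | i. 1 \<le> i \<and> i \<le> length ts} \<union>
     {D i j | i j. 1 \<le> i \<and> i \<le> length ts \<and> 1 \<le> j \<and> j \<le> ts ! (i - 1) - 2} \<union>
     {E j | j. 1 \<le> j \<and> j \<le> a}"

inductive_set stirling_gen :: "nat list \<Rightarrow> nat list \<Rightarrow> stirling_elem rel"
  for as ts :: "nat list" where
  UC: "\<lbrakk>1 \<le> i; i \<le> length ts; 1 \<le> j; j \<le> as ! (i - 1)\<rbrakk> \<Longrightarrow> (U i j, C i) \<in> stirling_gen as ts"
| CD: "\<lbrakk>1 \<le> i; i \<le> length ts; ts ! (i - 1) > 2\<rbrakk> \<Longrightarrow> (C i, D i 1) \<in> stirling_gen as ts"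
| DD: "\<lbrakk>1 \<le> i; i \<le> length ts; 1 \<le> j; j < ts ! (i - 1) - 2\<rbrakk>
         \<Longrightarrow> (D i j, D i (j + 1)) \<in> stirling_gen as ts"
| DC: "\<lbrakk>1 \<le> i; i < length ts; ts ! (i - 1) > 2\<rbrakk>
         \<Longrightarrow> (D i (ts ! (i - 1) - 2), C (i + 1)) \<in> stirling_gen as ts"
| CC: "\<lbrakk>1 \<le> i; i < length ts; ts ! (i - 1) = 2\<rbrakk> \<Longrightarrow> (C i, C (i + 1)) \<in> stirling_gen as ts"

definition stirling_order :: "nat list \<Rightarrow> nat list \<Rightarrow> nat \<Rightarrow> stirling_elem rel" where
  "stirling_order as ts a = Restr ((stirling_gen as ts)\<^sup>*) (stirling_carrier as ts a)"

text \<open>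
  A poset is given by its carrier \<open>P\<close> and its reflexive order relation \<open>r\<close>.  Maps out of \<open>P\<close>
  are extensional, so that each map on the carrier is counted once.
\<close>

definition Omega :: "'a set \<Rightarrow> 'a rel \<Rightarrow> nat \<Rightarrow> nat" where
  "Omega P r m =
     card {f \<in> P \<rightarrow>\<^sub>E {1..m}. \<forall>x\<in>P. \<forall>y\<in>P. (x, y) \<in> r \<and> x \<noteq> y \<longrightarrow> f x \<le> f y}"

definition Omega_strict :: "'a set \<Rightarrow> 'a rel \<Rightarrow> nat \<Rightarrow> nat" where
  "Omega_strict P r m =
     card {f \<in> P \<rightarrow>\<^sub>E {1..m}. \<forall>x\<in>P. \<forall>y\<in>P. (x, y) \<in> r \<and> x \<noteq> y \<longrightarrow> f x < f y}"

fun stirling_rank :: "stirling_elem \<Rightarrow> nat \<times> nat" where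
  "stirling_rank (U i j) = (i, 0)"
| "stirling_rank (C i) = (i, 1)"
| "stirling_rank (D i j) = (i, j + 1)"
| "stirling_rank (E j) = (0, 0)"

lemma stirling_gen_subset_carrier:
  "stirling_gen as ts \<subseteq> stirling_carrier as ts a \<times> stirling_carrier as ts a"
  by (auto simp: stirling_carrier_def elim!: stirling_gen.cases)

lemma partial_order_stirling_order:
  "partial_order_on (stirling_carrier as ts a) (stirling_order as ts a)"
proof -
  have "stirling_gen as ts \<subseteq> inv_image (less_than <*lex*> less_than) stirling_rank"
    by (auto elim!: stirling_gen.cases)
  then have "wf (stirling_gen as ts)"
    by (meson wf_subset wf_inv_image wf_lex_prod wf_less_than)
  then have "antisym ((stirling_gen as ts)\<^sup>*)"
    by (simp add: acyclic_impl_antisym_rtrancl wf_acyclic)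
  then show ?thesis
    unfolding partial_order_on_def preorder_on_def stirling_order_def
    by (auto simp: refl_on_def antisym_def intro!: transI dest: rtrancl_trans)
qed

end

theory Submission
  imports Defs "HOL-Library.Sublist"
begin

text \<open>
  Appending an entry \<open>t\<close> to \<open>k\<close> means inserting a block of \<open>t\<close> copies of a new largest letter
  into one of the \<open>K + 1\<close> gaps of a Stirling permutation; the number of descents is kept at a
  descent and grows by one elsewhere. For the generating functions \<open>F\<close> of \<open>B\<close> and \<open>b\<close> this reads
  \<open>F(k, t) = G^(t-1) x F(k)'\<close> with \<open>G = 1/(1-x)\<close> for \<open>B\<close> and \<open>G = x/(1-x)\<close> for \<open>b\<close>. On the
  poset side, the operator \<open>x d/dx\<close>, which multiplies the \<open>m\<close>-th coefficient by \<open>m\<close>, adds an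
  isolated element, and multiplication by \<open>G\<close>, which takes partial sums, adds an element above all
  others. These are exactly the steps that build the Stirling poset.
\<close>

section \<open>Words avoiding the pattern 212\<close>

definition avoids_212 :: "'a::ord list \<Rightarrow> bool" where
  "avoids_212 \<sigma> \<longleftrightarrow> (\<forall>x y. subseq [x, y, x] \<sigma> \<longrightarrow> x \<le> y)"

lemma subseq_Cons_iff_nth:
  "subseq (x # xs) ys \<longleftrightarrow> (\<exists>i<length ys. ys ! i = x \<and> subseq xs (drop (Suc i) ys))"
proof
  assume "subseq (x # xs) ys"
  then obtain us vs where "ys = us @ x # vs" "subseq xs vs"
    by (auto dest: list_emb_ConsD)
  then show "\<exists>i<length ys. ys ! i = x \<and> subseq xs (drop (Suc i) ys)"
    by (intro exI[of _ "length us"]) auto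
next
  assume "\<exists>i<length ys. ys ! i = x \<and> subseq xs (drop (Suc i) ys)"
  then obtain i where nth_i: "i < length ys" "ys ! i = x" "subseq xs (drop (Suc i) ys)"
    by blast
  then have "ys = take i ys @ x # drop (Suc i) ys" using id_take_nth_drop[of i ys] by simp
  then show "subseq (x # xs) ys"
    using nth_i(3) by (metis subseq_Cons2 subseq_drop_many)
qed

lemma avoids_212_iff_nth:
  "avoids_212 \<sigma> \<longleftrightarrow>
    (\<forall>i s j. i < s \<and> s < j \<and> j < length \<sigma> \<and> \<sigma> ! i = \<sigma> ! j \<longrightarrow> \<sigma> ! s \<ge> \<sigma> ! i)"
proof -
  have pattern: "subseq [x, y, x] \<sigma> \<longleftrightarrow>
      (\<exists>i s j. i < s \<and> s < j \<and> j < length \<sigma> \<and> \<sigma> ! i = \<sigma> ! j \<and>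
        x = \<sigma> ! i \<and> y = \<sigma> ! s)"
    (is "_ \<longleftrightarrow> ?R") for x y
  proof
    assume "subseq [x, y, x] \<sigma>"
    then obtain i q r where "i < length \<sigma>" "q < length \<sigma> - Suc i"
        "r < length \<sigma> - Suc (Suc (q + i))" "\<sigma> ! i = x"
        "\<sigma> ! (Suc i + q) = y" "\<sigma> ! (Suc (Suc (q + i)) + r) = x"
      by (auto simp: subseq_Cons_iff_nth simp del: list_emb_Cons_iff1 list_emb_Cons_iff2)
    then show ?R
      by (intro exI[of _ i] exI[of _ "Suc i + q"] exI[of _ "Suc (Suc (q + i)) + r"]) auto
  next
    assume ?R
    then obtain i s j where indices: "i < s" "s < j" "j < length \<sigma>" "\<sigma> ! i = \<sigma> ! j"
        "x = \<sigma> ! i" "y = \<sigma> ! s"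
      by blast
    then have "subseq [x] (drop (Suc s) \<sigma>)"
      unfolding subseq_Cons_iff_nth by (intro exI[of _ "j - Suc s"]) auto
    with indices have "subseq [y, x] (drop (Suc i) \<sigma>)"
      unfolding subseq_Cons_iff_nth[of y] by (intro exI[of _ "s - Suc i"]) auto
    with indices show "subseq [x, y, x] \<sigma>"
      unfolding subseq_Cons_iff_nth[of x] by (intro exI[of _ i]) auto
  qed
  show ?thesis unfolding avoids_212_def pattern by blast
qed

lemma set_subseq_subset: "subseq xs ys \<Longrightarrow> set xs \<subseteq> set ys"
  by (auto elim: list_emb_set)

lemma avoids_212_subseq: "avoids_212 ys \<Longrightarrow> subseq xs ys \<Longrightarrow> avoids_212 xs"
  unfolding avoids_212_def by (meson subseq_order.trans)

lemma avoids_212_max_block: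
  fixes N :: "'a::linorder"
  assumes "avoids_212 w" "N \<in> set w" "\<forall>x\<in>set w. x \<le> N"
  obtains u v where "w = u @ replicate (count_list w N) N @ v" "N \<notin> set u" "N \<notin> set v"
proof -
  obtain u u' where first: "w = u @ N # u'" "N \<notin> set u"
    using split_list_first[OF assms(2)] by blast
  have "N \<in> set (N # u')" by simp
  then obtain z v where last: "N # u' = z @ N # v" "N \<notin> set v"
    using split_list_last by metis
  have w_eq: "w = u @ z @ N # v" using first(1) last(1) by simp
  have "y = N" if y_mem: "y \<in> set z" for y
  proof (rule ccontr)
    assume "y \<noteq> N"
    then obtain z' where z_eq: "z = N # z'" "y \<in> set z'"
      using y_mem last(1) by (cases z) auto
    then have "subseq ([N] @ [y] @ [N]) ((u @ [N]) @ z' @ N # v)"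
      by (intro list_emb_append_mono) (auto simp: subseq_singleton_left)
    then have "N \<le> y" using assms(1) by (simp add: w_eq z_eq(1) avoids_212_def)
    moreover have "y \<le> N" using y_mem assms(3) by (simp add: w_eq)
    ultimately show False using \<open>y \<noteq> N\<close> by simp
  qed
  then have block: "z @ [N] = replicate (length z + 1) N"
    by (intro replicate_eqI) auto
  have "count_list (z @ [N]) N = length z + 1"
    unfolding block by (simp add: count_list_eq_length_filter)
  then have "count_list w N = length z + 1" using first(2) last(2) by (simp add: w_eq)
  moreover have "w = u @ (z @ [N]) @ v" by (simp add: w_eq)
  ultimately show ?thesis using that first(2) last(2) block by metis
qed

section \<open>Inserting a block of the largest letter\<close>

definition insert_block :: "'a \<Rightarrow> nat \<Rightarrow> 'a list \<Rightarrow> nat \<Rightarrow> 'a list" where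
  "insert_block N t \<sigma> p = take p \<sigma> @ replicate t N @ drop p \<sigma>"

lemma length_insert_block [simp]: "length (insert_block N t \<sigma> p) = length \<sigma> + t"
  by (simp add: insert_block_def)

lemma set_insert_block:
  "set (insert_block N t \<sigma> p) = (if t = 0 then set \<sigma> else insert N (set \<sigma>))"
proof -
  have "set \<sigma> = set (take p \<sigma>) \<union> set (drop p \<sigma>)" by (simp flip: set_append)
  then show ?thesis by (auto simp: insert_block_def)
qed

lemma count_list_insert_block:
  "count_list (insert_block N t \<sigma> p) x = count_list \<sigma> x + (if x = N then t else 0)"
proof -
  have "count_list \<sigma> x = count_list (take p \<sigma>) x + count_list (drop p \<sigma>) x"
    by (simp flip: count_list_append)
  then show ?thesis by (simp add: insert_block_def count_list_eq_length_filter)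
qed

lemma filter_insert_block:
  assumes "N \<notin> set \<sigma>"
  shows "filter (\<lambda>x. x \<noteq> N) (insert_block N t \<sigma> p) = \<sigma>"
proof -
  have "filter (\<lambda>x. x \<noteq> N) (insert_block N t \<sigma> p) = filter (\<lambda>x. x \<noteq> N) (take p \<sigma> @ drop p \<sigma>)"
    unfolding insert_block_def filter_append by simp
  then show ?thesis using assms by (auto simp: filter_id_conv)
qed

lemma length_takeWhile_insert_block:
  assumes "t > 0" "N \<notin> set \<sigma>" "p \<le> length \<sigma>"
  shows "length (takeWhile (\<lambda>x. x \<noteq> N) (insert_block N t \<sigma> p)) = p"
proof -
  have "takeWhile (\<lambda>x. x \<noteq> N) (take p \<sigma> @ replicate t N @ drop p \<sigma>) = take p \<sigma>"
    using assms(1,2) by (subst takeWhile_append2) (auto simp: gr0_conv_Suc dest: in_set_takeD)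
  then show ?thesis using assms(3) by (simp add: insert_block_def)
qed

lemma subseq_enclosed_by_block:
  assumes "subseq [N, y, N] (u @ replicate t N @ v)" "N \<notin> set u" "N \<notin> set v"
  shows "y = N"
proof -
  obtain xs ys zs where split: "[N, y, N] = xs @ ys @ zs"
    and sub: "subseq xs u" "subseq ys (replicate t N)" "subseq zs v"
    using assms(1) unfolding subseq_append_iff by blast
  have "N \<notin> set xs" "N \<notin> set zs"
    using sub(1,3) assms(2,3) by (auto dest: set_subseq_subset)
  then have "xs = []" "zs = []" using split by (auto simp: Cons_eq_append_conv)
  then have "y \<in> set ys" using split by auto
  then show ?thesis using set_subseq_subset[OF sub(2)] by auto
qed

lemma avoids_212_insert_block:
  fixes N :: "'a::linorder"
  assumes "\<forall>x\<in>set \<sigma>. x < N"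
  shows "avoids_212 (insert_block N t \<sigma> p) \<longleftrightarrow> avoids_212 \<sigma>"
proof
  have "subseq (take p \<sigma> @ [] @ drop p \<sigma>) (insert_block N t \<sigma> p)"
    unfolding insert_block_def by (intro list_emb_append_mono) auto
  then show "avoids_212 (insert_block N t \<sigma> p) \<Longrightarrow> avoids_212 \<sigma>"
    by (auto intro: avoids_212_subseq)
next
  assume avoids: "avoids_212 \<sigma>"
  have new: "N \<notin> set \<sigma>" using assms by auto
  show "avoids_212 (insert_block N t \<sigma> p)"
    unfolding avoids_212_def
  proof (intro allI impI)
    fix x y assume sub: "subseq [x, y, x] (insert_block N t \<sigma> p)"
    consider (middle_new) "y = N" | (outer_new) "x = N" "y \<noteq> N" | (both_old) "x \<noteq> N" "y \<noteq> N"
      by blast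
    then show "x \<le> y"
    proof cases
      case middle_new
      have "x \<in> insert N (set \<sigma>)"
        using set_subseq_subset[OF sub] by (auto simp: set_insert_block split: if_splits)
      then show ?thesis using middle_new assms by auto
    next
      case outer_new
      then show ?thesis
        using sub new subseq_enclosed_by_block[of N y "take p \<sigma>" t "drop p \<sigma>"]
        by (auto simp: insert_block_def dest: in_set_takeD in_set_dropD)
    next
      case both_old
      then have "subseq [x, y, x] \<sigma>"
        using subseq_filter[OF sub, of "\<lambda>z. z \<noteq> N"] by (simp add: filter_insert_block[OF new])
      then show ?thesis using avoids by (simp add: avoids_212_def)
    qed
  qed
qed

section \<open>Stirling permutations\<close>

lemma mem_stirling_perms_iff:
  "\<sigma> \<in> stirling_perms k \<longleftrightarrow> length \<sigma> = sum_list k \<and> set \<sigma> \<subseteq> {1..length k} \<and>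
     (\<forall>i\<in>{1..length k}. count_list \<sigma> i = k ! (i - 1)) \<and> avoids_212 \<sigma>"
  by (simp add: stirling_perms_def avoids_212_iff_nth)

lemma length_stirling_perms: "\<sigma> \<in> stirling_perms k \<Longrightarrow> length \<sigma> = sum_list k"
  by (simp add: stirling_perms_def)

lemma stirling_perms_letter_less:
  "\<sigma> \<in> stirling_perms k \<Longrightarrow> x \<in> set \<sigma> \<Longrightarrow> x < Suc (length k)"
  by (auto simp: stirling_perms_def)

lemma finite_stirling_perms: "finite (stirling_perms k)"
  by (rule finite_subset[OF _ finite_lists_length_eq[of "{1..length k}" "sum_list k"]])
    (auto simp: stirling_perms_def)

lemma insert_block_mem_stirling_perms_iff:
  assumes "t > 0" "set \<sigma> \<subseteq> {1..length k}"
  shows "insert_block (Suc (length k)) t \<sigma> p \<in> stirling_perms (k @ [t]) \<longleftrightarrow> \<sigma> \<in> stirling_perms k"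
proof -
  let ?N = "Suc (length k)"
  have avoids: "avoids_212 (insert_block ?N t \<sigma> p) \<longleftrightarrow> avoids_212 \<sigma>"
    using assms(2) by (intro avoids_212_insert_block) auto
  have "count_list \<sigma> ?N = 0" using assms(2) by (intro count_notin) auto
  moreover have "{1..?N} = insert ?N {1..length k}" by auto
  ultimately have "(\<forall>i\<in>{1..length (k @ [t])}.
        count_list (insert_block ?N t \<sigma> p) i = (k @ [t]) ! (i - 1)) \<longleftrightarrow>
      (\<forall>i\<in>{1..length k}. count_list \<sigma> i = k ! (i - 1))"
    by (auto simp: count_list_insert_block nth_append)
  then show ?thesis
    using assms avoids by (auto simp: mem_stirling_perms_iff set_insert_block)
qed

lemma stirling_perms_snocE:
  assumes "w \<in> stirling_perms (k @ [t])" "t > 0"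
  obtains \<sigma> p where "\<sigma> \<in> stirling_perms k" "p \<le> sum_list k"
    "w = insert_block (Suc (length k)) t \<sigma> p"
proof -
  let ?N = "Suc (length k)"
  have w_props: "avoids_212 w" "set w \<subseteq> {1..?N}" "count_list w ?N = t"
    using assms(1) by (auto simp: mem_stirling_perms_iff nth_append)
  have "?N \<in> set w" using w_props(3) assms(2) by (metis count_notin less_irrefl)
  moreover have "\<forall>x\<in>set w. x \<le> ?N" using w_props(2) by auto
  ultimately obtain u v where decomp: "w = u @ replicate t ?N @ v"
      "?N \<notin> set u" "?N \<notin> set v"
    using avoids_212_max_block[OF w_props(1)] w_props(3) by metis
  then have w_eq: "w = insert_block ?N t (u @ v) (length u)" by (simp add: insert_block_def)
  have "set (u @ v) \<subseteq> {1..?N} - {?N}" using w_props(2) decomp by auto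
  also have "\<dots> \<subseteq> {1..length k}" by auto
  finally have "u @ v \<in> stirling_perms k"
    using insert_block_mem_stirling_perms_iff[OF assms(2)] assms(1) w_eq by blast
  moreover from length_stirling_perms[OF this] have "length u \<le> sum_list k" by simp
  ultimately show ?thesis using w_eq that by blast
qed

lemma bij_betw_insert_block:
  assumes "t > 0"
  shows "bij_betw (\<lambda>(\<sigma>, p). insert_block (Suc (length k)) t \<sigma> p)
    (stirling_perms k \<times> {..sum_list k}) (stirling_perms (k @ [t]))"
  (is "bij_betw ?ins ?A _")
  unfolding bij_betw_def
proof
  let ?N = "Suc (length k)"
  show "inj_on ?ins ?A"
  proof (rule inj_on_inverseI)
    fix \<sigma>p assume "\<sigma>p \<in> ?A"
    then have "?N \<notin> set (fst \<sigma>p)" and "snd \<sigma>p \<le> length (fst \<sigma>p)"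
      using stirling_perms_letter_less by (fastforce simp: length_stirling_perms)+
    then show "(\<lambda>w. (filter (\<lambda>x. x \<noteq> ?N) w, length (takeWhile (\<lambda>x. x \<noteq> ?N) w))) (?ins \<sigma>p) = \<sigma>p"
      by (simp add: case_prod_unfold filter_insert_block length_takeWhile_insert_block[OF assms])
  qed
  show "?ins ` ?A = stirling_perms (k @ [t])"
  proof (intro equalityI subsetI)
    fix w assume "w \<in> ?ins ` ?A"
    then obtain \<sigma> p where "\<sigma> \<in> stirling_perms k" "w = insert_block ?N t \<sigma> p" by auto
    moreover from this(1) have "set \<sigma> \<subseteq> {1..length k}" by (simp add: mem_stirling_perms_iff)
    ultimately show "w \<in> stirling_perms (k @ [t])"
      using insert_block_mem_stirling_perms_iff[OF assms] by blast
  next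
    fix w assume "w \<in> stirling_perms (k @ [t])"
    then show "w \<in> ?ins ` ?A" by (elim stirling_perms_snocE[OF _ assms]) auto
  qed
qed

lemma sum_stirling_perms_snoc:
  assumes "t > 0"
  shows "(\<Sum>w\<in>stirling_perms (k @ [t]). F w) =
    (\<Sum>\<sigma>\<in>stirling_perms k. \<Sum>p\<le>sum_list k. F (insert_block (Suc (length k)) t \<sigma> p))"
  unfolding sum.reindex_bij_betw[OF bij_betw_insert_block[OF assms], symmetric]
  by (simp add: sum.cartesian_product case_prod_unfold)

section \<open>Descents\<close>

lemma descents_Nil [simp]: "descents [] = {}"
  by (simp add: descents_def)

lemma descents_subset: "descents \<sigma> \<subseteq> {1..length \<sigma>}"
  by (auto simp: descents_def)

lemma finite_descents [simp]: "finite (descents \<sigma>)"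
  by (simp add: descents_def)

lemma length_mem_descents: "\<sigma> \<noteq> [] \<Longrightarrow> length \<sigma> \<in> descents \<sigma>"
  by (simp add: descents_def Suc_le_eq)

lemma descents_append:
  "descents (u @ v) - {length u} = (descents u - {length u}) \<union> (+) (length u) ` descents v"
proof (rule set_eqI)
  fix i
  show "i \<in> descents (u @ v) - {length u} \<longleftrightarrow>
      i \<in> (descents u - {length u}) \<union> (+) (length u) ` descents v"
  proof (cases "i \<le> length u")
    case True
    have "i \<notin> (+) (length u) ` descents v" using True descents_subset[of v] by auto
    then show ?thesis using True by (auto simp: descents_def nth_append)
  next
    case False
    then obtain q where i_eq: "i = length u + Suc q"
      by (metis less_imp_Suc_add not_less add_Suc_right)
    then have "i \<in> (+) (length u) ` descents v \<longleftrightarrow> Suc q \<in> descents v" by auto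
    then show ?thesis unfolding i_eq by (auto simp: descents_def nth_append)
  qed
qed

lemma card_descents_append:
  "card (descents (u @ v) - {length u}) = card (descents u - {length u}) + card (descents v)"
proof -
  have "descents u \<inter> (+) (length u) ` descents v = {}"
    using descents_subset[of u] descents_subset[of v] by fastforce
  then show ?thesis
    unfolding descents_append by (subst card_Un_disjoint) (auto simp: card_image)
qed

lemma card_descents_replicate_append:
  assumes "t > 0" "\<forall>x\<in>set v. x < N"
  shows "card (descents (replicate t N @ v)) = card (descents v) + 1"
proof -
  have "descents (replicate t N) - {t} = {}" by (auto simp: descents_def)
  then have "card (descents (replicate t N @ v) - {t}) = card (descents v)"
    using card_descents_append[of "replicate t N" v]
    by (simp only: length_replicate card.empty add_0)
  moreover have "t \<in> descents (replicate t N @ v)"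
    using assms by (auto simp: descents_def nth_append)
  ultimately show ?thesis
    using card.remove[OF finite_descents, of t "replicate t N @ v"] by linarith
qed

lemma card_descents_insert_block:
  assumes "t > 0" "p \<le> length \<sigma>" "\<forall>x\<in>set \<sigma>. x < N"
  shows "card (descents (insert_block N t \<sigma> p)) =
    (if p \<in> descents \<sigma> then card (descents \<sigma>) else card (descents \<sigma>) + 1)"
proof -
  define u v where "u = take p \<sigma>" and "v = drop p \<sigma>"
  have length_u: "length u = p" and \<sigma>_eq: "\<sigma> = u @ v" using assms(2) by (simp_all add: u_def v_def)
  have v_less: "\<forall>x\<in>set v. x < N" using assms(3) by (simp add: \<sigma>_eq)
  have insert_eq: "insert_block N t \<sigma> p = u @ replicate t N @ v"
    by (simp add: insert_block_def u_def v_def)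
  have "\<not> N < u ! (p - 1)" if "p \<ge> 1"
    using bspec[OF assms(3), of "u ! (p - 1)"] length_u that by (auto simp: \<sigma>_eq)
  then have "p \<notin> descents (insert_block N t \<sigma> p)"
    using assms(1) length_u by (auto simp: insert_eq descents_def nth_append)
  then have "card (descents (insert_block N t \<sigma> p)) = card (descents (insert_block N t \<sigma> p) - {p})"
    by simp
  also have "\<dots> = card (descents u - {p}) + (card (descents v) + 1)"
    using card_descents_append[of u "replicate t N @ v"]
      card_descents_replicate_append[OF assms(1) v_less] by (simp add: insert_eq length_u)
  also have "\<dots> = card (descents \<sigma> - {p}) + 1"
    using card_descents_append[of u v] by (simp add: length_u \<sigma>_eq)
  also have "\<dots> = (if p \<in> descents \<sigma> then card (descents \<sigma>) else card (descents \<sigma>) + 1)"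
    using card.remove[OF finite_descents, of p \<sigma>] by simp
  finally show ?thesis .
qed

lemma card_descents_le: "card (descents \<sigma>) \<le> length \<sigma>"
  using card_mono[OF _ descents_subset] by fastforce

lemma card_descents_pos: "\<sigma> \<noteq> [] \<Longrightarrow> card (descents \<sigma>) > 0"
  using length_mem_descents by (auto simp: card_gt_0_iff)

lemma card_descents_stirling_perms_le:
  assumes "\<sigma> \<in> stirling_perms k" "\<forall>x\<in>set k. x > 0"
  shows "card (descents \<sigma>) \<le> length k"
  using assms
proof (induction k arbitrary: \<sigma> rule: rev_induct)
  case Nil
  then show ?case by (simp add: stirling_perms_def)
next
  case (snoc t k)
  then have t_pos: "t > 0" by simp
  obtain \<tau> p where \<tau>_props: "\<tau> \<in> stirling_perms k" "p \<le> sum_list k"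
    and \<sigma>_eq: "\<sigma> = insert_block (Suc (length k)) t \<tau> p"
    using stirling_perms_snocE[OF snoc.prems(1) t_pos] .
  have "card (descents \<sigma>) \<le> card (descents \<tau>) + 1"
    using stirling_perms_letter_less[OF \<tau>_props(1)] \<tau>_props t_pos
    by (simp add: \<sigma>_eq card_descents_insert_block length_stirling_perms)
  also have "\<dots> \<le> length (k @ [t])" using snoc.IH[OF \<tau>_props(1)] snoc.prems(2) by simp
  finally show ?case .
qed

text \<open>
  In the strict case the non-descents among the \<open>K + 1\<close> gaps are marked, so that the number of
  marked gaps is the exponent \<open>K + 1 - des \<sigma>\<close> in the numerator defining \<open>b\<close>.
\<close>

definition marked_gaps :: "bool \<Rightarrow> nat list \<Rightarrow> nat set" where
  "marked_gaps strict \<sigma> = {p \<in> {..length \<sigma>}. p \<in> descents \<sigma> \<longleftrightarrow> \<not> strict}"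

lemma card_marked_gaps:
  "card (marked_gaps strict \<sigma>) =
    (if strict then length \<sigma> + 1 - card (descents \<sigma>) else card (descents \<sigma>))"
proof -
  have sub: "descents \<sigma> \<subseteq> {..length \<sigma>}" using descents_subset[of \<sigma>] by auto
  then have "marked_gaps strict \<sigma> = (if strict then {..length \<sigma>} - descents \<sigma> else descents \<sigma>)"
    by (auto simp: marked_gaps_def)
  then show ?thesis using sub by (simp add: card_Diff_subset)
qed

lemma card_marked_gaps_insert_block:
  assumes "t > 0" "p \<le> length \<sigma>" "\<forall>x\<in>set \<sigma>. x < N"
  shows "card (marked_gaps strict (insert_block N t \<sigma> p)) =
    of_bool strict * (t - 1) + card (marked_gaps strict \<sigma>) + of_bool (p \<notin> marked_gaps strict \<sigma>)"
proof -
  have "p \<in> marked_gaps strict \<sigma> \<longleftrightarrow> (p \<in> descents \<sigma> \<longleftrightarrow> \<not> strict)"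
    using assms(2) by (simp add: marked_gaps_def)
  then show ?thesis
    using assms card_descents_le[of \<sigma>]
    by (auto simp: card_marked_gaps card_descents_insert_block)
qed

lemma sum_marked_gaps_insert_block:
  fixes x :: "'a::comm_ring_1" and strict :: bool
  assumes "t > 0" "\<forall>y\<in>set \<sigma>. y < N"
  defines "c \<equiv> card (marked_gaps strict \<sigma>)"
  shows "(\<Sum>p\<le>length \<sigma>. x ^ card (marked_gaps strict (insert_block N t \<sigma> p))) =
    (x ^ of_bool strict) ^ (t - 1) *
      (of_nat c * x ^ c + (of_nat (length \<sigma> + 1) - of_nat c) * x ^ (c + 1))"
proof -
  let ?G = "marked_gaps strict \<sigma>"
  have sub: "?G \<subseteq> {..length \<sigma>}" by (auto simp: marked_gaps_def)
  have "(\<Sum>p\<le>length \<sigma>. x ^ card (marked_gaps strict (insert_block N t \<sigma> p))) =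
      (\<Sum>p\<le>length \<sigma>. (x ^ of_bool strict) ^ (t - 1) * (if p \<in> ?G then x ^ c else x ^ (c + 1)))"
    using assms(1,2)
    by (intro sum.cong) (simp_all add: card_marked_gaps_insert_block c_def power_add power_mult)
  also have "\<dots> = (x ^ of_bool strict) ^ (t - 1) *
      (\<Sum>p\<le>length \<sigma>. if p \<in> ?G then x ^ c else x ^ (c + 1))"
    by (simp only: sum_distrib_left)
  also have "(\<Sum>p\<le>length \<sigma>. if p \<in> ?G then x ^ c else x ^ (c + 1)) =
      of_nat (card ?G) * x ^ c + of_nat (card ({..length \<sigma>} - ?G)) * x ^ (c + 1)"
    using sub by (simp add: sum.If_cases Int_absorb1 Diff_eq)
  also have "of_nat (card ({..length \<sigma>} - ?G)) = (of_nat (length \<sigma> + 1) - of_nat c :: 'a)"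
    using sub card_mono[OF _ sub] finite_subset[OF sub]
    by (simp add: card_Diff_subset c_def of_nat_diff)
  finally show ?thesis by (simp add: c_def)
qed

section \<open>The generating functions of the numbers \<open>B\<close> and \<open>b\<close>\<close>

definition spacing_fps :: "nat \<Rightarrow> 'a::field fps" where
  "spacing_fps s = fps_X ^ s * inverse (1 - fps_X)"

lemma fps_XD_X_power_over_one_minus_X_power:
  fixes c M :: nat
  defines "w \<equiv> inverse (1 - fps_X :: 'a::field fps)"
  shows "fps_XD (fps_X ^ c * w ^ M) =
    (of_nat c * fps_X ^ c + (of_nat M - of_nat c) * fps_X ^ (c + 1)) * w ^ Suc M"
proof -
  have inv: "w * (1 - fps_X) = 1" unfolding w_def by (rule inverse_mult_eq_1) simp
  have deriv_w: "fps_deriv w = w ^ 2"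
    unfolding w_def by (subst fps_inverse_deriv) (simp_all add: power2_eq_square)
  have XD_X: "fps_XD (fps_X ^ c) = of_nat c * (fps_X ^ c :: 'a fps)"
    by (rule fps_ext) (simp flip: fps_of_nat)
  have "fps_deriv (w ^ M) = of_nat M * (w ^ 2 * w ^ (M - 1))"
    by (simp add: fps_deriv_power deriv_w fps_of_nat)
  then have XD_w: "fps_XD (w ^ M) = of_nat M * fps_X * w ^ Suc M"
    by (cases M) (simp_all add: fps_XD_def power2_eq_square)
  have "fps_XD (fps_X ^ c * w ^ M) = fps_XD (fps_X ^ c) * w ^ M + fps_X ^ c * fps_XD (w ^ M)"
    by (simp add: fps_XD_def algebra_simps)
  also have "\<dots> = of_nat c * fps_X ^ c * ((w * (1 - fps_X)) * w ^ M) +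
      of_nat M * fps_X ^ (c + 1) * w ^ Suc M"
    unfolding XD_X XD_w inv by (simp add: algebra_simps)
  also have "\<dots> = (of_nat c * fps_X ^ c + (of_nat M - of_nat c) * fps_X ^ (c + 1)) * w ^ Suc M"
    by (simp add: algebra_simps)
  finally show ?thesis .
qed

definition stirling_fps :: "bool \<Rightarrow> nat list \<Rightarrow> rat fps" where
  "stirling_fps strict k = (\<Sum>\<sigma>\<in>stirling_perms k. fps_X ^ card (marked_gaps strict \<sigma>))
    * inverse (1 - fps_X) ^ (sum_list k + 1)"

lemma stirling_fps_Nil: "stirling_fps strict [] = spacing_fps (of_bool strict)"
proof -
  have "stirling_perms [] = {[]}" by (auto simp: stirling_perms_def)
  then show ?thesis by (simp add: stirling_fps_def spacing_fps_def card_marked_gaps)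
qed

lemma stirling_fps_snoc:
  assumes "t > 0"
  shows "stirling_fps strict (k @ [t]) =
    spacing_fps (of_bool strict) ^ (t - 1) * fps_XD (stirling_fps strict k)"
proof -
  let ?w = "inverse (1 - fps_X :: rat fps)" and ?Xs = "fps_X ^ of_bool strict :: rat fps"
  let ?K = "sum_list k" and ?c = "\<lambda>\<sigma>. card (marked_gaps strict \<sigma>)"
  let ?T = "\<lambda>\<sigma>. of_nat (?c \<sigma>) * fps_X ^ ?c \<sigma> +
    (of_nat (?K + 1) - of_nat (?c \<sigma>)) * fps_X ^ (?c \<sigma> + 1)"
  have insertions: "(\<Sum>p\<le>?K. fps_X ^ ?c (insert_block (Suc (length k)) t \<sigma> p)) =
      ?Xs ^ (t - 1) * ?T \<sigma>" if "\<sigma> \<in> stirling_perms k" for \<sigma>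
    using sum_marked_gaps_insert_block[OF assms, where \<sigma> = \<sigma> and x = "fps_X :: rat fps"]
      stirling_perms_letter_less[OF that] length_stirling_perms[OF that] by metis
  have "(\<Sum>w\<in>stirling_perms (k @ [t]). fps_X ^ ?c w) =
      ?Xs ^ (t - 1) * (\<Sum>\<sigma>\<in>stirling_perms k. ?T \<sigma>)"
    by (simp add: sum_stirling_perms_snoc[OF assms] insertions flip: sum_distrib_left)
  moreover have "sum_list (k @ [t]) + 1 = (t - 1) + Suc (?K + 1)" using assms by simp
  ultimately have "stirling_fps strict (k @ [t]) =
      spacing_fps (of_bool strict) ^ (t - 1) *
        (\<Sum>\<sigma>\<in>stirling_perms k. ?T \<sigma> * ?w ^ Suc (?K + 1))"
    unfolding stirling_fps_def spacing_fps_def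
    by (simp only: power_add power_mult_distrib sum_distrib_left sum_distrib_right mult_ac)
  also have "(\<Sum>\<sigma>\<in>stirling_perms k. ?T \<sigma> * ?w ^ Suc (?K + 1)) =
      (\<Sum>\<sigma>\<in>stirling_perms k. fps_XD (fps_X ^ ?c \<sigma> * ?w ^ (?K + 1)))"
    by (simp only: fps_XD_X_power_over_one_minus_X_power)
  also have "\<dots> = fps_XD (stirling_fps strict k)"
    by (simp only: stirling_fps_def fps_XD_def comp_apply sum_distrib_left sum_distrib_right
        fps_deriv_sum)
  finally show ?thesis .
qed

lemma stirling_fps_append_ones:
  "stirling_fps strict (k @ replicate n 1) = (fps_XD ^^ n) (stirling_fps strict k)"
proof (induction n)
  case (Suc n)
  have "k @ replicate (Suc n) 1 = (k @ replicate n 1) @ [1]"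
    by (simp add: replicate_append_same)
  then show ?case
    using Suc stirling_fps_snoc[of 1 strict "k @ replicate n 1"] by simp
qed simp

lemma sum_A_num:
  fixes F :: "nat \<Rightarrow> 'a::semiring_1"
  assumes "k \<noteq> []" "\<forall>x\<in>set k. x > 0"
  shows "(\<Sum>i=1..length k. of_nat (A_num k i) * F i) = (\<Sum>\<sigma>\<in>stirling_perms k. F (card (descents \<sigma>)))"
proof -
  have "card (descents \<sigma>) \<in> {1..length k}" if "\<sigma> \<in> stirling_perms k" for \<sigma>
  proof -
    have "\<sigma> \<noteq> []" using length_stirling_perms[OF that] assms by (cases k) auto
    then show ?thesis
      using card_descents_stirling_perms_le[OF that assms(2)] card_descents_pos[of \<sigma>] by simp
  qed
  then have "(\<Sum>\<sigma>\<in>stirling_perms k. F (card (descents \<sigma>))) =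
      (\<Sum>i=1..length k. \<Sum>\<sigma>\<in>{\<sigma>\<in>stirling_perms k. card (descents \<sigma>) = i}. F (card (descents \<sigma>)))"
    by (intro sum.group[symmetric] finite_stirling_perms) auto
  also have "\<dots> = (\<Sum>i=1..length k. of_nat (A_num k i) * F i)"
    by (intro sum.cong) (auto simp: A_num_def)
  finally show ?thesis by simp
qed

lemma fps_divide_one_minus_X_power:
  "f / (1 - fps_X) ^ n = f * inverse (1 - fps_X :: 'a::field fps) ^ n"
  by (subst fps_divide_unit) (auto simp: fps_inverse_power)

lemma B_num_eq_stirling_fps:
  assumes "k \<noteq> []" "\<forall>x\<in>set k. x > 0"
  shows "B_num k m = fps_nth (stirling_fps False k) m"
  unfolding B_num_def stirling_fps_def sum_A_num[OF assms] fps_divide_one_minus_X_power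
  by (simp add: card_marked_gaps)

lemma b_num_eq_stirling_fps:
  assumes "k \<noteq> []" "\<forall>x\<in>set k. x > 0"
  shows "b_num k m = fps_nth (stirling_fps True k) m"
proof -
  let ?K = "sum_list k" and ?n = "length k"
  have "?n \<le> ?K" using assms(2) by (induction k) auto
  then have "(\<Sum>i = ?K - ?n + 1..?K. of_nat (A_num k (?K + 1 - i)) * fps_X ^ i) =
      (\<Sum>i=1..?n. of_nat (A_num k i) * fps_X ^ (?K + 1 - i) :: rat fps)"
    by (intro sum.reindex_bij_witness[of _ "\<lambda>i. ?K + 1 - i" "\<lambda>i. ?K + 1 - i"]) auto
  also have "\<dots> = (\<Sum>\<sigma>\<in>stirling_perms k. fps_X ^ (?K + 1 - card (descents \<sigma>)))"
    by (rule sum_A_num[OF assms])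
  also have "\<dots> = (\<Sum>\<sigma>\<in>stirling_perms k. fps_X ^ card (marked_gaps True \<sigma>))"
    by (intro sum.cong) (simp_all add: card_marked_gaps length_stirling_perms)
  finally show ?thesis
    unfolding b_num_def stirling_fps_def fps_divide_one_minus_X_power by simp
qed

section \<open>Maps with prescribed gaps along a relation\<close>

definition spaced_maps :: "nat \<Rightarrow> 'a rel \<Rightarrow> 'a set \<Rightarrow> nat \<Rightarrow> ('a \<Rightarrow> nat) set" where
  "spaced_maps s r P m =
    {f \<in> P \<rightarrow>\<^sub>E {1..m}. \<forall>x\<in>P. \<forall>y\<in>P. (x, y) \<in> r \<longrightarrow> f x + s \<le> f y}"

lemma Omega_eq_card_spaced_maps: "Omega P r m = card (spaced_maps 0 (r - Id) P m)"
  by (simp add: Omega_def spaced_maps_def)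

lemma Omega_strict_eq_card_spaced_maps: "Omega_strict P r m = card (spaced_maps 1 (r - Id) P m)"
  by (simp add: Omega_strict_def spaced_maps_def Suc_le_eq)

lemma spaced_maps_Restr: "spaced_maps s (Restr r P) P m = spaced_maps s r P m"
  by (auto simp: spaced_maps_def)

lemma finite_spaced_maps: "finite P \<Longrightarrow> finite (spaced_maps s r P m)"
  unfolding spaced_maps_def by (rule finite_subset[of _ "P \<rightarrow>\<^sub>E {1..m}"]) (auto intro: finite_PiE)

lemma card_spaced_maps_insert:
  assumes "finite P" "z \<notin> P"
    and extend: "\<And>f v. f \<in> extensional P \<Longrightarrow> v \<in> {1..m} \<Longrightarrow>
      f(z := v) \<in> spaced_maps s r (insert z P) m \<longleftrightarrow> f \<in> spaced_maps s r P (g v)"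
  shows "card (spaced_maps s r (insert z P) m) = (\<Sum>v=1..m. card (spaced_maps s r P (g v)))"
proof -
  let ?ext = "\<lambda>(v, f). f(z := v)" and ?S = "SIGMA v:{1..m}. spaced_maps s r P (g v)"
  have extensional: "f \<in> extensional Q" if "f \<in> spaced_maps s r Q n" for f n and Q :: "'a set"
    using that by (simp add: spaced_maps_def PiE_def)
  have "inj_on ?ext ?S"
    by (rule inj_on_subset[OF inj_combinator[OF assms(2), of "\<lambda>_. UNIV"]])
      (auto dest: extensional simp: PiE_def)
  moreover have "?ext ` ?S = spaced_maps s r (insert z P) m"
  proof (intro equalityI subsetI)
    fix h assume "h \<in> ?ext ` ?S"
    then show "h \<in> spaced_maps s r (insert z P) m" using extend extensional by auto
  next
    fix h assume h_mem: "h \<in> spaced_maps s r (insert z P) m"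
    then have "h \<in> insert z P \<rightarrow>\<^sub>E {1..m}" by (simp add: spaced_maps_def)
    then obtain v f where split: "v \<in> {1..m}" "f \<in> P \<rightarrow>\<^sub>E {1..m}" "h = f(z := v)"
      unfolding PiE_insert_eq by auto
    then have "f \<in> spaced_maps s r P (g v)" using extend[of f v] h_mem by (simp add: PiE_def)
    with split show "h \<in> ?ext ` ?S" by (auto intro: rev_image_eqI)
  qed
  ultimately have "card (spaced_maps s r (insert z P) m) = card ?S"
    using card_image by metis
  then show ?thesis using assms(1) by (simp add: card_SigmaI finite_spaced_maps)
qed

lemma card_spaced_maps_insert_isolated:
  assumes "finite P" "z \<notin> P" "\<And>x. x \<in> insert z P \<Longrightarrow> (x, z) \<notin> r \<and> (z, x) \<notin> r"
  shows "card (spaced_maps s r (insert z P) m) = m * card (spaced_maps s r P m)"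
proof -
  have "card (spaced_maps s r (insert z P) m) = (\<Sum>v=1..m. card (spaced_maps s r P m))"
  proof (rule card_spaced_maps_insert[OF assms(1,2)])
    fix f :: "'a \<Rightarrow> nat" and v assume "f \<in> extensional P" "v \<in> {1..m}"
    moreover have "x \<noteq> z" if "x \<in> P" for x using that assms(2) by auto
    ultimately show "f(z := v) \<in> spaced_maps s r (insert z P) m \<longleftrightarrow> f \<in> spaced_maps s r P m"
      using assms(3) by (auto simp: spaced_maps_def PiE_def Pi_def extensional_def)
  qed
  then show ?thesis by simp
qed

lemma card_spaced_maps_insert_top:
  assumes "finite P" "asym r" "\<And>x. x \<in> P \<Longrightarrow> (x, z) \<in> r"
  shows "card (spaced_maps s r (insert z P) m) = (\<Sum>v=1..m. card (spaced_maps s r P (v - s)))"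
proof (rule card_spaced_maps_insert[OF assms(1)])
  have "(z, z) \<notin> r" using assms(2) by (auto dest: asymD)
  then show "z \<notin> P" using assms(3) by auto
  fix f :: "'a \<Rightarrow> nat" and v assume f_ext: "f \<in> extensional P" and v_range: "v \<in> {1..m}"
  have "x \<noteq> z" "(z, x) \<notin> r" if "x \<in> P" for x
    using that assms(3)[OF that] \<open>z \<notin> P\<close> asymD[OF assms(2)] by auto
  then have "f(z := v) \<in> spaced_maps s r (insert z P) m \<longleftrightarrow>
      (\<forall>x\<in>P. f x \<in> {1..m} \<and> f x + s \<le> v) \<and> (\<forall>x\<in>P. \<forall>y\<in>P. (x, y) \<in> r \<longrightarrow> f x + s \<le> f y)"
    using f_ext v_range assms(3) \<open>(z, z) \<notin> r\<close>
    by (auto simp: spaced_maps_def PiE_def Pi_def extensional_def)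
  also have "(\<forall>x\<in>P. f x \<in> {1..m} \<and> f x + s \<le> v) \<longleftrightarrow> (\<forall>x\<in>P. f x \<in> {1..v - s})"
    using v_range by force
  also have "\<dots> \<and> (\<forall>x\<in>P. \<forall>y\<in>P. (x, y) \<in> r \<longrightarrow> f x + s \<le> f y) \<longleftrightarrow>
      f \<in> spaced_maps s r P (v - s)"
    using f_ext by (simp add: spaced_maps_def PiE_def Pi_def Ball_def)
  finally show "f(z := v) \<in> spaced_maps s r (insert z P) m \<longleftrightarrow> f \<in> spaced_maps s r P (v - s)" .
qed

definition spaced_fps :: "nat \<Rightarrow> 'a rel \<Rightarrow> 'a set \<Rightarrow> 'b::comm_ring_1 fps" where
  "spaced_fps s r P = Abs_fps (\<lambda>m. of_nat (card (spaced_maps s r P m)))"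

lemma spaced_fps_empty: "spaced_fps s r {} = spacing_fps 0"
  by (simp add: spaced_fps_def spaced_maps_def spacing_fps_def fps_inverse_one_minus_fps_X)

lemma spaced_fps_union_isolated:
  assumes "finite P" "finite A" "A \<inter> P = {}"
    and "\<And>x y. x \<in> A \<Longrightarrow> y \<in> A \<union> P \<Longrightarrow> (x, y) \<notin> r \<and> (y, x) \<notin> r"
  shows "(spaced_fps s r (A \<union> P) :: 'b::comm_ring_1 fps) = (fps_XD ^^ card A) (spaced_fps s r P)"
  using assms(2-)
proof (induction A)
  case (insert z A)
  have "card (spaced_maps s r (insert z (A \<union> P)) m) = m * card (spaced_maps s r (A \<union> P) m)" for m
    using assms(1) insert.hyps insert.prems by (intro card_spaced_maps_insert_isolated) auto
  then have "(spaced_fps s r (insert z (A \<union> P)) :: 'b fps) = fps_XD (spaced_fps s r (A \<union> P))"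
    by (intro fps_ext) (simp add: spaced_fps_def)
  then show ?case using insert by simp
qed simp

lemma fps_nth_spacing_fps_mult:
  fixes H :: "'a::field fps"
  assumes "fps_nth H 0 = 0"
  shows "fps_nth (spacing_fps s * H) m = (\<Sum>v=1..m. fps_nth H (v - s))"
proof -
  define F where "F = spacing_fps s * H"
  have "inverse (1 - fps_X) * (1 - fps_X) = (1 :: 'a fps)" by (rule inverse_mult_eq_1) simp
  then have "F * (1 - fps_X) = fps_X ^ s * H" by (simp add: F_def spacing_fps_def mult_ac)
  then have F_rec: "F = fps_X * F + fps_X ^ s * H" by (simp add: algebra_simps)
  have "fps_nth F m = (\<Sum>v=1..m. fps_nth H (v - s))"
  proof (induction m)
    case 0
    show ?case by (subst F_rec) (simp add: assms fps_X_power_mult_nth)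
  next
    case (Suc m)
    have "fps_nth F (Suc m) = fps_nth F m + fps_nth H (Suc m - s)"
      by (subst F_rec) (simp add: assms fps_X_power_mult_nth)
    then show ?case using Suc by simp
  qed
  then show ?thesis by (simp add: F_def)
qed

lemma spaced_fps_insert_top:
  assumes "finite P" "P \<noteq> {}" "asym r" "\<And>x. x \<in> P \<Longrightarrow> (x, z) \<in> r"
  shows "(spaced_fps s r (insert z P) :: 'b::field fps) = spacing_fps s * spaced_fps s r P"
proof (rule fps_ext)
  fix m
  have "spaced_maps s r P 0 = {}" using assms(2) by (auto simp: spaced_maps_def PiE_eq_empty_iff)
  then have "fps_nth (spaced_fps s r P :: 'b fps) 0 = 0" by (simp add: spaced_fps_def)
  from fps_nth_spacing_fps_mult[OF this, of s m]
  show "fps_nth (spaced_fps s r (insert z P) :: 'b fps) m =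
      fps_nth (spacing_fps s * spaced_fps s r P) m"
    using assms by (simp add: spaced_fps_def card_spaced_maps_insert_top)
qed

lemma spaced_fps_union_chain:
  assumes "finite P" "P \<noteq> {}" "asym r"
    and "\<And>x j. x \<in> P \<Longrightarrow> 1 \<le> j \<Longrightarrow> j \<le> n \<Longrightarrow> (x, d j) \<in> r"
    and "\<And>i j. 1 \<le> i \<Longrightarrow> i < j \<Longrightarrow> j \<le> n \<Longrightarrow> (d i, d j) \<in> r"
  shows "(spaced_fps s r (d ` {1..n} \<union> P) :: 'b::field fps) =
    spacing_fps s ^ n * spaced_fps s r P"
  using assms(4,5)
proof (induction n)
  case (Suc n)
  have "d ` {1..Suc n} \<union> P = insert (d (Suc n)) (d ` {1..n} \<union> P)"
    by (auto simp: atLeastAtMostSuc_conv)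
  moreover have "(spaced_fps s r (insert (d (Suc n)) (d ` {1..n} \<union> P)) :: 'b fps) =
      spacing_fps s * spaced_fps s r (d ` {1..n} \<union> P)"
    using assms(1-3) Suc.prems by (intro spaced_fps_insert_top) auto
  ultimately show ?case using Suc by (simp add: mult.assoc)
qed simp

section \<open>The Stirling poset\<close>

text \<open>
  The rank of \<open>E j\<close> has first component \<open>0\<close>; the ranks with second component \<open>0\<close> are those of
  the minimal elements \<open>U i j\<close> and \<open>E j\<close>.
\<close>

definition stirling_less :: "stirling_elem rel" where
  "stirling_less = {(x, y). fst (stirling_rank x) > 0 \<and> snd (stirling_rank y) > 0 \<and>
     (fst (stirling_rank x) < fst (stirling_rank y) \<or>
      fst (stirling_rank x) = fst (stirling_rank y) \<and>
        snd (stirling_rank x) < snd (stirling_rank y))}"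

lemma trans_stirling_less: "trans stirling_less"
  unfolding trans_def stirling_less_def mem_Collect_eq case_prod_conv by linarith

lemma asym_stirling_less: "asym stirling_less"
  unfolding asym_iff stirling_less_def mem_Collect_eq case_prod_conv by linarith

lemma stirling_gen_subset_less: "stirling_gen as ts \<subseteq> stirling_less"
  by (auto simp: stirling_less_def elim!: stirling_gen.cases)

lemma stirling_gen_pred_C:
  assumes "\<forall>t\<in>set ts. t \<ge> 2" "x \<in> stirling_carrier as ts a" "C i \<in> stirling_carrier as ts a"
    and "(x, C i) \<in> stirling_less"
  shows "\<exists>y. (y, C i) \<in> stirling_gen as ts \<and> (x, y) \<in> stirling_less\<^sup>="
proof (cases "\<exists>j. x = U i j")
  case True
  with assms(2) have "(x, C i) \<in> stirling_gen as ts"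
    by (auto simp: stirling_carrier_def intro: stirling_gen.UC)
  then show ?thesis by blast
next
  case False
  define h where "h = i - 1"
  have "fst (stirling_rank x) > 0" "fst (stirling_rank x) < i"
    using False assms(4) by (cases x; auto simp: stirling_less_def)+
  then have rank_x: "fst (stirling_rank x) > 0" "fst (stirling_rank x) \<le> h"
    and h_bounds: "1 \<le> h" "h < length ts" "i = h + 1"
    using assms(3) by (auto simp: h_def stirling_carrier_def)
  then have "ts ! (h - 1) \<ge> 2" using assms(1) by simp
  then consider (no_D) "ts ! (h - 1) = 2" | (some_D) "ts ! (h - 1) > 2" by linarith
  then show ?thesis
  proof cases
    case no_D
    have "(x, C h) \<in> stirling_less\<^sup>="
      using rank_x h_bounds no_D assms(2)
      by (cases x) (auto simp: stirling_less_def stirling_carrier_def le_less)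
    then show ?thesis using stirling_gen.CC[OF h_bounds(1,2) no_D] h_bounds(3) by auto
  next
    case some_D
    have "(x, D h (ts ! (h - 1) - 2)) \<in> stirling_less\<^sup>="
      using rank_x h_bounds some_D assms(2)
      by (cases x) (auto simp: stirling_less_def stirling_carrier_def le_less)
    then show ?thesis using stirling_gen.DC[OF h_bounds(1,2) some_D] h_bounds(3) by auto
  qed
qed

lemma stirling_gen_pred_D:
  assumes "x \<in> stirling_carrier as ts a" "D i j \<in> stirling_carrier as ts a"
    and "(x, D i j) \<in> stirling_less"
  shows "\<exists>y. (y, D i j) \<in> stirling_gen as ts \<and> (x, y) \<in> stirling_less\<^sup>="
proof -
  have bounds: "1 \<le> i" "i \<le> length ts" "1 \<le> j" "j \<le> ts ! (i - 1) - 2"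
    using assms(2) by (auto simp: stirling_carrier_def)
  show ?thesis
  proof (cases "j = 1")
    case True
    then have "(x, C i) \<in> stirling_less\<^sup>="
      using assms(1,3) by (cases x) (auto simp: stirling_less_def stirling_carrier_def)
    moreover have "(C i, D i 1) \<in> stirling_gen as ts"
      using bounds by (intro stirling_gen.CD) auto
    ultimately show ?thesis using True by blast
  next
    case False
    define h where "h = j - 1"
    have h_bounds: "1 \<le> h" "h < ts ! (i - 1) - 2" "j = h + 1"
      using False bounds by (auto simp: h_def)
    have "(x, D i h) \<in> stirling_less\<^sup>="
      using assms(1,3) h_bounds by (cases x) (auto simp: stirling_less_def stirling_carrier_def)
    then show ?thesis using stirling_gen.DD[OF bounds(1,2) h_bounds(1,2)] h_bounds(3) by auto
  qed
qed

lemma stirling_less_imp_trancl: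
  assumes "\<forall>t\<in>set ts. t \<ge> 2" "x \<in> stirling_carrier as ts a" "y \<in> stirling_carrier as ts a"
    and "(x, y) \<in> stirling_less"
  shows "(x, y) \<in> (stirling_gen as ts)\<^sup>+"
  using wf_inv_image[OF wf_lex_prod[OF wf_less_than wf_less_than], of stirling_rank] assms(3,4)
proof (induction y rule: wf_induct_rule)
  case (less y)
  have "\<exists>z. (z, y) \<in> stirling_gen as ts \<and> (x, z) \<in> stirling_less\<^sup>="
  proof (cases y)
    case (C i)
    then show ?thesis using stirling_gen_pred_C[OF assms(1,2)] less.prems by blast
  next
    case (D i j)
    then show ?thesis using stirling_gen_pred_D[OF assms(2)] less.prems by blast
  qed (use less.prems(2) in \<open>auto simp: stirling_less_def\<close>)
  then obtain z where pred: "(z, y) \<in> stirling_gen as ts" "(x, z) \<in> stirling_less\<^sup>=" by blast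
  have "(z, y) \<in> stirling_less" using pred(1) stirling_gen_subset_less by blast
  then have "(z, y) \<in> inv_image (less_than <*lex*> less_than) stirling_rank"
    by (auto simp: stirling_less_def lex_prod_def case_prod_unfold)
  moreover have "z \<in> stirling_carrier as ts a" using pred(1) stirling_gen_subset_carrier by blast
  ultimately show ?case using pred less.IH by (auto intro: trancl_into_trancl)
qed

lemma stirling_order_diff_Id:
  assumes "\<forall>t\<in>set ts. t \<ge> 2"
  shows "stirling_order as ts a - Id = Restr stirling_less (stirling_carrier as ts a)"
proof -
  have "(stirling_gen as ts)\<^sup>+ \<subseteq> stirling_less"
    using trancl_mono_subset[OF stirling_gen_subset_less] trancl_id[OF trans_stirling_less] by metis
  then have "(x, y) \<in> stirling_order as ts a - Id \<longleftrightarrow> (x, y) \<in> stirling_less"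
    if "x \<in> stirling_carrier as ts a" "y \<in> stirling_carrier as ts a" for x y
    using stirling_less_imp_trancl[OF assms that] that asymD[OF asym_stirling_less, of x x]
    by (auto simp: stirling_order_def rtrancl_eq_or_trancl)
  then show ?thesis by (auto simp: stirling_order_def)
qed

lemma finite_stirling_carrier: "finite (stirling_carrier as ts a)"
proof -
  have "stirling_carrier as ts a \<subseteq>
      (\<lambda>(i, j). U i j) ` (SIGMA i:{1..length ts}. {1..as ! (i - 1)}) \<union> C ` {1..length ts} \<union>
      (\<lambda>(i, j). D i j) ` (SIGMA i:{1..length ts}. {1..ts ! (i - 1) - 2}) \<union> E ` {1..a}"
    by (auto simp: stirling_carrier_def)
  then show ?thesis by (rule finite_subset) auto
qed

lemma stirling_rank_carrier:
  "e \<in> stirling_carrier as ts 0 \<Longrightarrow> fst (stirling_rank e) \<in> {1..length ts}"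
  by (auto simp: stirling_carrier_def)

lemma stirling_carrier_Nil: "stirling_carrier [] [] 0 = {}"
  by (auto simp: stirling_carrier_def)

lemma stirling_carrier_eq_union_E:
  "stirling_carrier as ts a = E ` {1..a} \<union> stirling_carrier as ts 0"
  by (auto simp: stirling_carrier_def)

lemma stirling_carrier_snoc:
  assumes "length as = length ts"
  shows "stirling_carrier (as @ [x]) (ts @ [t]) 0 = D (Suc (length ts)) ` {1..t - 2} \<union>
    insert (C (Suc (length ts))) (U (Suc (length ts)) ` {1..x} \<union> stirling_carrier as ts 0)"
proof (rule set_eqI)
  show "e \<in> stirling_carrier (as @ [x]) (ts @ [t]) 0 \<longleftrightarrow> e \<in> D (Suc (length ts)) ` {1..t - 2} \<union>
    insert (C (Suc (length ts))) (U (Suc (length ts)) ` {1..x} \<union> stirling_carrier as ts 0)" for e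
    using assms by (cases e) (auto simp: stirling_carrier_def nth_append le_Suc_eq image_iff)
qed

lemma spaced_fps_stirling_carrier_snoc:
  assumes "length as = length ts" "x > 0" "t \<ge> 2"
  shows "(spaced_fps s stirling_less (stirling_carrier (as @ [x]) (ts @ [t]) 0) :: 'a::field fps) =
    spacing_fps s ^ (t - 1) * (fps_XD ^^ x) (spaced_fps s stirling_less (stirling_carrier as ts 0))"
proof -
  let ?i = "Suc (length ts)" and ?P = "stirling_carrier as ts 0"
  let ?PU = "U ?i ` {1..x} \<union> ?P"
  let ?PUC = "insert (C ?i) ?PU"
  let ?fps = "spaced_fps s stirling_less :: stirling_elem set \<Rightarrow> 'a fps"
  have with_U: "?fps ?PU = (fps_XD ^^ x) (?fps ?P)"
  proof -
    have "?fps ?PU = (fps_XD ^^ card (U ?i ` {1..x})) (?fps ?P)"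
      by (rule spaced_fps_union_isolated)
        (auto simp: finite_stirling_carrier stirling_less_def dest: stirling_rank_carrier)
    then show ?thesis by (simp add: card_image inj_on_def)
  qed
  have with_C: "?fps ?PUC = spacing_fps s * ?fps ?PU"
    using assms(2)
    by (intro spaced_fps_insert_top asym_stirling_less)
      (auto simp: finite_stirling_carrier stirling_less_def dest: stirling_rank_carrier)
  have with_D: "?fps (D ?i ` {1..t - 2} \<union> ?PUC) = spacing_fps s ^ (t - 2) * ?fps ?PUC"
    by (intro spaced_fps_union_chain asym_stirling_less)
      (auto simp: finite_stirling_carrier stirling_less_def dest: stirling_rank_carrier)
  have "t - 1 = Suc (t - 2)" using assms(3) by simp
  then show ?thesis
    by (simp only: stirling_carrier_snoc[OF assms(1)] with_U with_C with_D power_Suc mult_ac)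
qed

lemma spaced_fps_stirling_carrier:
  "spaced_fps s stirling_less (stirling_carrier as ts a) =
    (fps_XD ^^ a) (spaced_fps s stirling_less (stirling_carrier as ts 0))"
proof -
  have "spaced_fps s stirling_less (E ` {1..a} \<union> stirling_carrier as ts 0) =
      (fps_XD ^^ card (E ` {1..a})) (spaced_fps s stirling_less (stirling_carrier as ts 0))"
    by (rule spaced_fps_union_isolated)
      (auto simp: finite_stirling_carrier stirling_less_def dest: stirling_rank_carrier)
  then show ?thesis
    by (simp add: stirling_carrier_eq_union_E[of as ts a] card_image inj_on_def)
qed

section \<open>Matching the two recursions\<close>

text \<open>
  In the strict case the constant coefficients differ (\<open>0\<close> against \<open>1\<close>); \<^const>\<open>fps_XD\<close> removes them.
\<close>

lemma fps_XD_stirling_fps_Nil: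
  "fps_XD (stirling_fps strict []) = fps_XD (spaced_fps s r {})"
  by (rule fps_ext)
    (simp add: stirling_fps_Nil spaced_fps_empty spacing_fps_def fps_X_power_mult_nth
      fps_inverse_one_minus_fps_X)

lemma has_weight_snocE:
  assumes "has_weight k as (ts @ [t]) 0"
  obtains k' as' n where "has_weight k' as' ts 0" "as = as' @ [Suc n]"
    "k = (k' @ replicate n 1) @ [t]" "t \<ge> 2"
proof -
  obtain as' x where as_eq: "as = as' @ [x]"
    using assms by (cases as rule: rev_cases) (auto simp: has_weight_def)
  moreover obtain n where "x = Suc n"
    using assms as_eq by (cases x) (auto simp: has_weight_def)
  ultimately show ?thesis using assms that by (auto simp: has_weight_def)
qed

lemma fps_XD_stirling_fps_no_trailing_ones:
  assumes "has_weight k as ts 0"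
  shows "fps_XD (stirling_fps strict k) =
    fps_XD (spaced_fps (of_bool strict) stirling_less (stirling_carrier as ts 0))"
  using assms
proof (induction ts arbitrary: k as rule: rev_induct)
  case Nil
  then have "k = []" "as = []" by (auto simp: has_weight_def)
  then show ?case by (simp add: stirling_carrier_Nil fps_XD_stirling_fps_Nil)
next
  case (snoc t ts)
  from snoc.prems obtain k' as' n where weight: "has_weight k' as' ts 0"
    and as_eq: "as = as' @ [Suc n]"
    and k_eq: "k = (k' @ replicate n 1) @ [t]" and t_ge: "t \<ge> 2"
    by (rule has_weight_snocE)
  let ?G = "spacing_fps (of_bool strict) :: rat fps"
  let ?poset = "\<lambda>as ts. spaced_fps (of_bool strict) stirling_less (stirling_carrier as ts 0)"
  have "t > 0" using t_ge by simp
  then have "stirling_fps strict k = ?G ^ (t - 1) * fps_XD ((fps_XD ^^ n) (stirling_fps strict k'))"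
    by (simp only: k_eq stirling_fps_snoc stirling_fps_append_ones)
  also have "\<dots> = ?G ^ (t - 1) * (fps_XD ^^ n) (fps_XD (stirling_fps strict k'))"
    by (simp only: funpow_swap1)
  also have "\<dots> = ?G ^ (t - 1) * (fps_XD ^^ Suc n) (?poset as' ts)"
    by (simp only: snoc.IH[OF weight] funpow_Suc_right comp_apply)
  also have "\<dots> = ?poset as (ts @ [t])"
    using weight t_ge
    by (simp only: as_eq has_weight_def spaced_fps_stirling_carrier_snoc zero_less_Suc)
  finally show ?case by (rule arg_cong)
qed

lemma fps_XD_stirling_fps:
  assumes "has_weight k as ts a"
  shows "fps_XD (stirling_fps strict k) =
    fps_XD (spaced_fps (of_bool strict) stirling_less (stirling_carrier as ts a))"
proof -
  obtain k' where weight: "has_weight k' as ts 0" and k_eq: "k = k' @ replicate a 1"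
    using assms by (simp add: has_weight_def)
  have "fps_XD (stirling_fps strict k) = (fps_XD ^^ a) (fps_XD (stirling_fps strict k'))"
    by (simp only: k_eq stirling_fps_append_ones funpow_swap1)
  also have "\<dots> = fps_XD (spaced_fps (of_bool strict) stirling_less (stirling_carrier as ts a))"
    by (simp only: fps_XD_stirling_fps_no_trailing_ones[OF weight]
        spaced_fps_stirling_carrier[of _ as ts a] funpow_swap1)
  finally show ?thesis .
qed

lemma fps_nth_stirling_fps:
  assumes "has_weight k as ts a" "m > 0"
  shows "fps_nth (stirling_fps strict k) m =
    of_nat (card (spaced_maps (of_bool strict) (stirling_order as ts a - Id)
      (stirling_carrier as ts a) m))"
proof -
  have "\<forall>t\<in>set ts. t \<ge> 2" using assms(1) by (simp add: has_weight_def)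
  then show ?thesis
    using arg_cong[OF fps_XD_stirling_fps[OF assms(1)], of "\<lambda>F. fps_nth F m"] assms(2)
    by (simp add: stirling_order_diff_Id spaced_maps_Restr spaced_fps_def)
qed

theorem theorem2:
  fixes k as ts :: "nat list" and a m :: nat
  assumes "k \<noteq> []"
    and "\<forall>x\<in>set k. x > 0"
    and "has_weight k as ts a"
    and "m > 0"
  shows "B_num k m = of_nat (Omega (stirling_carrier as ts a) (stirling_order as ts a) m) \<and>
         b_num k m = of_nat (Omega_strict (stirling_carrier as ts a) (stirling_order as ts a) m)"
proof
  let ?P = "stirling_carrier as ts a" and ?r = "stirling_order as ts a"
  have "B_num k m = fps_nth (stirling_fps False k) m"
    by (rule B_num_eq_stirling_fps[OF assms(1,2)])
  also have "\<dots> = of_nat (card (spaced_maps 0 (?r - Id) ?P m))"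
    using fps_nth_stirling_fps[OF assms(3,4), of False] by simp
  also have "\<dots> = of_nat (Omega ?P ?r m)" by (simp only: Omega_eq_card_spaced_maps)
  finally show "B_num k m = of_nat (Omega ?P ?r m)" .
  have "b_num k m = fps_nth (stirling_fps True k) m"
    by (rule b_num_eq_stirling_fps[OF assms(1,2)])
  also have "\<dots> = of_nat (card (spaced_maps 1 (?r - Id) ?P m))"
    using fps_nth_stirling_fps[OF assms(3,4), of True] by simp
  also have "\<dots> = of_nat (Omega_strict ?P ?r m)" by (simp only: Omega_strict_eq_card_spaced_maps)
  finally show "b_num k m = of_nat (Omega_strict ?P ?r m)" .
qed

end
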